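(* Let $\mathcal{M}=\{A_1,\dots,A_m\}\subset\mathbb{R}^{n\times n}$ be a finite set of $m$ matrices, all of which are nonsingular. Let $\delta_i=s_1(A_i)$ be the smallest singular value of $A_i$ and $\Delta_i=|\det A_i|$. Let $$\Sigma_m=\Big\{\nu\in[0,1]^m : \sum_{h=1}^m\nu_h=1\Big\},\qquad \Psi:\Sigma_m\to\mathbb{R},\quad \Psi(\nu)=\sum_{h=1}^m\nu_h\log\left(\frac{\nu_h\Delta_h}{\delta_h^n}\right)$$ (with the convention $0\log 0=0$), let $\bar\nu\in\Sigma_m$ be defined by $\bar\nu_h=\dfrac{\Delta_h^{-1}}{\sum_{j=1}^m\Delta_j^{-1}}$, and let $\tilde\rho_-=\Big(\sum_{h=1}^m\Delta_h^{-1}\Big)^{-1/n}$. Then the following alternative holds. (a) If $\Psi(\bar\nu)\ge 0$, then $\tilde\rho(\mathcal{M})\ge\tilde\rho_-\ge\min_{h=1,\dots,m}\delta_h$. (b) If $\Psi(\bar\nu)<0$, then the set $\mathcal{Z}=\{\nu\in\Sigma_m:\Psi(\nu)=0\}$ is nonempty and, setting $$\tilde\rho_-^*:=\min_{\nu\in\mathcal{Z}}\prod_{h=1}^m\delta_h^{\nu_h},$$ one has $\tilde\rho_-^*\ge\min_{h=1,\dots,m}\delta_h$ and $$\tilde\rho(\mathcal{M})\ge\tilde\rho_-^*>\tilde\rho_-.$$ Moreover, if $\delta_i\ne\delta_j$ for every $i\neq j$, then the argument of the minimum defining $\tilde\rho_-^*$ takes the form $\hat\nu=\hat\nu(\beta)$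 with $$\hat\nu_h(\beta)=\begin{cases}0 & \text{if } h\notin S,\\[2pt] \dfrac{\delta_h^{\beta}\Delta_h^{-1}}{\sum_{j\in S}\delta_j^{\beta}\Delta_j^{-1}} & \text{if } h\in S,\end{cases}$$ for some real $\beta$ and some nonempty $S\subseteq\{1,\dots,m\}$. As a consequence, in that case $\tilde\rho_-^*$ is the minimum of $\prod_{h=1}^m\delta_h^{\hat\nu_h(\beta)}$ over all solutions $\beta\in\mathbb{R}$ of the scalar equations $\Psi(\hat\nu_1(\beta),\dots,\hat\nu_m(\beta))=0$ obtained for all possible nonempty $S\subseteq\{1,\dots,m\}$.
   Context: Given a finite set $\mathcal{M}=\{A_1,\dots,A_m\}\subset\mathbb{R}^{n\times n}$, a solution of the switched system starting at $x_0\in\mathbb{R}^n$ is a sequence $(x(k))_{k\ge 0}$ with $x(0)=x_0$ and $x(k+1)=A_{\sigma_k}x(k)$ for all $k\ge 0$, for some switching signal $\sigma:\mathbb{N}\to\{1,\dots,m\}$ (which may depend on $x_0$). Let $|\cdot|$ be the Euclidean norm. For $x_0\in\mathbb{R}^n$ define $$\tilde\rho_{x_0}(\mathcal{M})=\inf\{\lambda\ge 0 : \exists\text{ a solution } x(\cdot)\text{ starting at }x_0\text{ and } M>0 \text{ such that } |x(k)|\le M\lambda^k|x_0|\ \forall k\ge 0\}.$$ The stabilizability radius of $\mathcal{M}$ is $\tilde\rho(\mathcal{M})=\sup_{x_0\in\mathbb{R}^n}\tilde\rho_{x_0}(\mathcal{M})$. It is known (from earlier work) that equivalently $$\tilde\rho(\mathcal{M})=\inf\{\lambda\ge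 0:\exists M>0\text{ such that for every }x_0\in\mathbb{R}^n\text{ some solution }x(\cdot)\text{ starting at }x_0\text{ satisfies }|x(k)|\le M\lambda^k|x_0|\ \forall k\ge 0\}.$$ Singular values of a matrix $A\in\mathbb{R}^{n\times n}$ are ordered as $s_1(A)\le s_2(A)\le\dots\le s_n(A)$. *)

theory Defs
  imports "HOL-Analysis.Analysis"
begin

section \<open>Switched systems and the stabilizability radius\<close>

text \<open>
  A finite set of \<open>m\<close> matrices of size \<open>n \<times> n\<close> is given by an enumeration \<open>A :: 'm \<Rightarrow> real^'n^'n\<close>
  with \<open>m = CARD('m)\<close> and \<open>n = CARD('n)\<close>; both are at least 1 because types are nonempty.
\<close>

definition is_solution ::
  "('m::finite \<Rightarrow> real^'n::finite^'n) \<Rightarrow> real^'n \<Rightarrow> (nat \<Rightarrow> real^'n) \<Rightarrow> bool" where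
  "is_solution A x0 x \<longleftrightarrow>
     x 0 = x0 \<and> (\<exists>\<sigma> :: nat \<Rightarrow> 'm. \<forall>k. x (Suc k) = A (\<sigma> k) *v x k)"

text \<open>
  The infimum and the supremum below are taken over nonempty bounded sets of reals: with
  \<open>L = (MAX h. onorm (( *v) (A h)))\<close> every solution satisfies \<open>norm (x k) \<le> L ^ k * norm x0\<close>.
  Note that \<open>0 ^ 0 = 1\<close>, so \<open>\<lambda> = 0\<close> is admissible iff some solution vanishes from \<open>k = 1\<close> on.
\<close>

definition stabilizability_radius_at ::
  "('m::finite \<Rightarrow> real^'n::finite^'n) \<Rightarrow> real^'n \<Rightarrow> real" where
  "stabilizability_radius_at A x0 =
     Inf {l :: real. 0 \<le> l \<and>
       (\<exists>x M. is_solution A x0 x \<and> M > 0 \<and> (\<forall>k. norm (x k) \<le> M * l ^ k * norm x0))}"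

definition stabilizability_radius :: "('m::finite \<Rightarrow> real^'n::finite^'n) \<Rightarrow> real" where
  "stabilizability_radius A = (SUP x0. stabilizability_radius_at A x0)"

section \<open>Singular values\<close>

text \<open>The singular values are the nonnegative square roots of the eigenvalues of \<open>A\<^sup>T A\<close>.\<close>

definition singular_value :: "real^'n::finite^'n \<Rightarrow> real \<Rightarrow> bool" where
  "singular_value A s \<longleftrightarrow>
     0 \<le> s \<and> (\<exists>v. v \<noteq> 0 \<and> (transpose A ** A) *v v = s\<^sup>2 *\<^sub>R v)"

definition smallest_singular_value :: "real^'n::finite^'n \<Rightarrow> real" where
  "smallest_singular_value A = (LEAST s. singular_value A s)"

section \<open>The quantities entering the lower bounds\<close>

definition delta :: "('m::finite \<Rightarrow> real^'n::finite^'n) \<Rightarrow> 'm \<Rightarrow> real" where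
  "delta A h = smallest_singular_value (A h)"

definition Delta :: "('m::finite \<Rightarrow> real^'n::finite^'n) \<Rightarrow> 'm \<Rightarrow> real" where
  "Delta A h = \<bar>det (A h)\<bar>"

definition prob_simplex :: "(real^'m::finite) set" where
  "prob_simplex = {\<nu>. (\<forall>h. 0 \<le> \<nu> $ h \<and> \<nu> $ h \<le> 1) \<and> (\<Sum>h\<in>UNIV. \<nu> $ h) = 1}"

text \<open>The convention \<open>0 log 0 = 0\<close> holds automatically, since \<open>0 * ln 0 = 0\<close>.\<close>

definition Psi :: "('m::finite \<Rightarrow> real^'n::finite^'n) \<Rightarrow> real^'m \<Rightarrow> real" where
  "Psi A \<nu> = (\<Sum>h\<in>UNIV. \<nu> $ h * ln (\<nu> $ h * Delta A h / delta A h ^ CARD('n)))"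

definition nu_bar :: "('m::finite \<Rightarrow> real^'n::finite^'n) \<Rightarrow> real^'m" where
  "nu_bar A = (\<chi> h. inverse (Delta A h) / (\<Sum>j\<in>UNIV. inverse (Delta A j)))"

definition rho_minus :: "('m::finite \<Rightarrow> real^'n::finite^'n) \<Rightarrow> real" where
  "rho_minus A = (\<Sum>h\<in>UNIV. inverse (Delta A h)) powr (- 1 / real CARD('n))"

definition Psi_zeros :: "('m::finite \<Rightarrow> real^'n::finite^'n) \<Rightarrow> (real^'m) set" where
  "Psi_zeros A = {\<nu> \<in> prob_simplex. Psi A \<nu> = 0}"

text \<open>
  In Isabelle \<open>0 powr 0 = 0\<close>; this is harmless here, since \<open>delta A h > 0\<close> whenever \<open>A h\<close> is
  invertible.
\<close>

definition delta_prod :: "('m::finite \<Rightarrow> real^'n::finite^'n) \<Rightarrow> real^'m \<Rightarrow> real" where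
  "delta_prod A \<nu> = (\<Prod>h\<in>UNIV. delta A h powr (\<nu> $ h))"

text \<open>
  The set of zeros is in general infinite, so the minimum is expressed by \<open>LEAST\<close> rather than
  \<open>Min\<close>; it is meaningful only where a minimizer is known to exist.
\<close>

definition rho_minus_star :: "('m::finite \<Rightarrow> real^'n::finite^'n) \<Rightarrow> real" where
  "rho_minus_star A = (LEAST r. r \<in> delta_prod A ` Psi_zeros A)"

definition nu_hat ::
  "('m::finite \<Rightarrow> real^'n::finite^'n) \<Rightarrow> 'm set \<Rightarrow> real \<Rightarrow> real^'m" where
  "nu_hat A S \<beta> = (\<chi> h. if h \<in> S
     then delta A h powr \<beta> * inverse (Delta A h)
            / (\<Sum>j\<in>S. delta A j powr \<beta> * inverse (Delta A j))
     else 0)"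

end

theory Submission
  imports Defs
begin

text \<open>
  Two facts carry the proof, both parametrised by a real number \<open>\<beta>\<close>. Put
  \<open>Z(\<beta>) = (\<Sum>h. \<delta>\<^sub>h powr \<beta> / \<Delta>\<^sub>h)\<close>, the \<open>partition_sum\<close> below, let \<open>p(\<beta>)\<close> be the distribution with
  weights \<open>\<delta>\<^sub>h powr \<beta> / (\<Delta>\<^sub>h * Z(\<beta>))\<close>, which is \<open>nu_hat A UNIV \<beta>\<close>, and let \<open>n\<close> be the dimension.

  The first fact is a lower bound for the radius, \<open>Z(\<beta>) powr (- 1 / (n - \<beta>))\<close> for every \<open>\<beta> \<le> 0\<close>
  (\<open>stabilizability_radius_ge_partition_sum\<close>). An initial state of norm at least 1 that can be
  steered below \<open>N * l ^ k\<close> at time \<open>k\<close> lies in the preimage of a ball under one of the \<open>m ^ k\<close>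
  products of matrices. The determinant gives the volume of this preimage, and the \<open>\<delta>\<close>s restrict the
  products that can occur, because no product contracts a vector more than the product of its \<open>\<delta>\<close>s.
  Weighting the products by a power \<open>\<beta> \<le> 0\<close> of this contraction turns the restricted sum into
  the full sum \<open>Z(\<beta>) ^ k\<close>, as in Chernoff's bound. If \<open>l\<close> is below the bound, the total volume tends
  to 0, so that the states which can be steered at rate \<open>l\<close> form a negligible set. For \<open>\<beta> = 0\<close> the bound
  is \<open>rho_minus\<close>.

  The second fact is the identity \<open>\<Psi>(\<nu>) = D(\<nu>, p(\<beta>)) - (n - \<beta>) * ln (\<Prod>h. \<delta>\<^sub>h powr \<nu>\<^sub>h) - ln Z(\<beta>)\<close> with the
  relative entropy \<open>D\<close> (\<open>Psi_eq_relative_entropy\<close>). For \<open>\<beta> = 0\<close>, where \<open>p(0)\<close> is \<open>nu_bar\<close>, it gives all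
  comparisons with \<open>rho_minus\<close>. If \<open>\<beta> < n\<close> and \<open>\<Psi>(p(\<beta>)) = 0\<close>, then Gibbs' inequality shows that
  \<open>p(\<beta>)\<close> is the unique minimiser of \<open>delta_prod\<close> on the zeros of \<open>\<Psi>\<close>, with minimum
  \<open>Z(\<beta>) powr (- 1 / (n - \<beta>))\<close>: exactly the lower bound for the radius.

  It remains to find such a \<open>\<beta>\<close> when \<open>\<Psi>(nu_bar) < 0\<close> (\<open>Psi_zero_cases\<close>). Let \<open>\<beta>\<close> run from 0 to minus
  infinity; \<open>p(\<beta>)\<close> then tends to a distribution on the matrices with the smallest \<open>\<delta>\<close>. If \<open>\<Psi>\<close> is
  positive there, the intermediate value theorem gives \<open>\<beta> < 0\<close>. Otherwise \<open>\<Psi>\<close> has a zero on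
  the face of the simplex spanned by these matrices, since \<open>\<Psi>\<close> is nonnegative at the vertices; there
  \<open>delta_prod\<close> equals the smallest \<open>\<delta>\<close>, which bounds both \<open>delta_prod\<close> and the radius from below.
\<close>

section \<open>Volumes under linear maps\<close>

text \<open>The index type carries no order, so that triangular matrices make no sense. Every linear map is
  a composition of elementary ones, and for those it suffices to look at boxes. A shear of a box is moved to the nonnegative orthant by a translation, and its
  determinant is computed as a row operation.\<close>

lemma measure_linear_image_finite:
  fixes f :: "real^'n::finite \<Rightarrow> real^'n"
  assumes "linear f" "S \<in> lmeasurable"
  shows "f ` S \<in> lmeasurable \<and> measure lebesgue (f ` S) = \<bar>det (matrix f)\<bar> * measure lebesgue S"
proof -
  have "\<forall>S\<in>lmeasurable. f ` S \<in> lmeasurable \<and>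
      measure lebesgue (f ` S) = \<bar>det (matrix f)\<bar> * measure lebesgue S"
    (is "?P f")
    using assms(1)
  proof (rule induct_linear_elementary)
    fix f g :: "real^'n \<Rightarrow> real^'n"
    assume lin: "linear f" "linear g" and P: "?P f" "?P g"
    have "det (matrix (f \<circ> g)) = det (matrix f) * det (matrix g)"
      by (simp only: matrix_compose[OF lin(2,1)] det_mul)
    moreover have "f ` g ` S \<in> lmeasurable \<and> measure lebesgue (f ` g ` S)
        = \<bar>det (matrix f)\<bar> * (\<bar>det (matrix g)\<bar> * measure lebesgue S)" if "S \<in> lmeasurable" for S
      using bspec[OF P(1), of "g ` S"] bspec[OF P(2) that] by (elim conjE) (simp only: simp_thms)
    ultimately show "?P (f \<circ> g)"
      unfolding image_comp[symmetric] by (simp only: abs_mult mult.assoc) blast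
  next
    fix f :: "real^'n \<Rightarrow> real^'n" and i
    assume f: "linear f" "\<And>x. f x $ i = 0"
    have "f x \<noteq> axis i 1" for x using f(2)[of x] by (auto simp: axis_def)
    then have "\<not> surj f" by (metis surjD)
    then have ninj: "\<not> inj f" using f(1) linear_injective_imp_surjective by blast
    have "det (matrix f) = 0" using ninj det_nz_iff_inj[OF f(1)] by blast
    moreover have "negligible (f ` S)" for S
      using negligible_linear_singular_image[OF f(1) ninj] .
    ultimately show "?P f"
      by (simp add: negligible_iff_measure)
  next
    fix c :: "'n \<Rightarrow> real"
    have "det (matrix (\<lambda>x. \<chi> i. c i * x $ i)) = prod c UNIV"
      by (subst det_diagonal) (simp_all add: matrix_def axis_def)
    then show "?P (\<lambda>x. \<chi> i. c i * x $ i)"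
      by (simp add: measurable_stretch measure_stretch)
  next
    fix m n :: 'n assume mn: "m \<noteq> n"
    let ?t = "Transposition.transpose m n"
    let ?h = "\<lambda>x::real^'n. \<chi> i. x $ ?t i"
    have lin: "linear ?h" by (rule linearI) (simp_all add: vec_eq_iff)
    have "matrix ?h = (\<chi> i. (mat 1 :: real^'n^'n) $ ?t i)"
      by (auto simp: matrix_def mat_def axis_def vec_eq_iff)
    then have det: "\<bar>det (matrix ?h)\<bar> = 1"
      using det_permute_rows[OF permutes_swap_id[of m UNIV n], of "mat 1 :: real^'n^'n"] mn
      by (simp add: sign_swap_id)
    have box: "measure lebesgue (?h ` cbox a b) = 1 * measure lebesgue (cbox a b)" for a b
    proof -
      have "?h ` cbox a b = cbox (?h a) (?h b)"
      proof (intro set_eqI iffI)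
        fix x assume "x \<in> cbox (?h a) (?h b)"
        then have "?h x \<in> cbox a b" by (simp add: mem_box_cart) (metis transpose_involutory)
        moreover have "x = ?h (?h x)" by (simp add: vec_eq_iff)
        ultimately show "x \<in> ?h ` cbox a b" by blast
      qed (auto simp: mem_box_cart)
      moreover have "(\<Prod>i\<in>UNIV. b $ ?t i - a $ ?t i) = (\<Prod>i\<in>UNIV. b $ i - a $ i)"
        by (rule prod.reindex_bij_betw) (rule bij_transpose)
      moreover have "cbox (?h a) (?h b) = {} \<longleftrightarrow> cbox a b = {}"
        using calculation(1) by (metis image_is_empty)
      ultimately show ?thesis by (simp add: content_cbox_if_cart)
    qed
    show "?P ?h"
    proof
      fix S :: "(real^'n) set" assume "S \<in> lmeasurable"
      from measure_linear_sufficient[OF lin this box]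
      show "?h ` S \<in> lmeasurable \<and>
          measure lebesgue (?h ` S) = \<bar>det (matrix ?h)\<bar> * measure lebesgue S"
        by (elim conjE, intro conjI) (simp_all only: det abs_one mult_1)
    qed
  next
    fix m n :: 'n assume mn: "m \<noteq> n"
    let ?h = "\<lambda>x::real^'n. \<chi> i. if i = m then x $ m + x $ n else x $ i"
    have lin: "linear ?h" by (rule linearI) (auto simp: vec_eq_iff algebra_simps)
    have "matrix ?h = (\<chi> k. if k = m then row m (mat 1) + 1 *s row n (mat 1) else row k (mat 1))"
      by (auto simp: matrix_def mat_def row_def axis_def vec_eq_iff)
    then have det: "det (matrix ?h) = 1"
      using det_row_operation[OF mn, of "mat 1 :: real^'n^'n" 1] by simp
    have box: "measure lebesgue (?h ` cbox a b) = 1 * measure lebesgue (cbox a b)" for a b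
    proof (cases "cbox a b = {}")
      case False
      have "cbox a b = (+) a ` cbox 0 (b - a)" using cbox_translation[of a 0 "b - a"] by simp
      moreover have "?h ` ((+) a ` B) = (+) (?h a) ` (?h ` B)" for B
        unfolding image_image by (simp only: linear_add[OF lin])
      moreover have "cbox 0 (b - a) \<noteq> {}" using False calculation(1) by blast
      ultimately show ?thesis
        using measure_shear_interval[OF mn, of 0 "b - a"]
        by (simp add: measure_translation)
    qed simp
    show "?P ?h"
    proof
      fix S :: "(real^'n) set" assume "S \<in> lmeasurable"
      from measure_linear_sufficient[OF lin this box]
      show "?h ` S \<in> lmeasurable \<and>
          measure lebesgue (?h ` S) = \<bar>det (matrix ?h)\<bar> * measure lebesgue S"
        by (elim conjE, intro conjI) (simp_all only: det abs_one mult_1)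
    qed
  qed
  then show ?thesis using assms(2) by blast
qed

section \<open>The smallest singular value and the determinant\<close>

text \<open>A minimiser \<open>v\<close> of \<open>norm (A *v x)\<close> on the unit sphere makes the quadratic form
  \<open>norm (A *v x)\<^sup>2 - \<mu>\<^sup>2 * norm x\<^sup>2\<close> nonnegative with a zero at \<open>v\<close>. Its first variation vanishes
  there, which says that \<open>v\<close> is an eigenvector of \<open>transpose A ** A\<close>.\<close>

lemma smallest_singular_value_attained:
  fixes A :: "real^'n::finite^'n"
  shows "\<exists>v. norm v = 1 \<and> smallest_singular_value A = norm (A *v v) \<and>
    (\<forall>x. norm (A *v v) * norm x \<le> norm (A *v x))"
proof -
  have "\<exists>v\<in>sphere 0 1. \<forall>x\<in>sphere 0 1. norm (A *v v) \<le> norm (A *v x)"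
    by (intro continuous_attains_inf continuous_intros
        linear_continuous_on_compose[OF _ matrix_vector_mul_linear]) auto
  then obtain v where v: "norm v = 1"
    and vmin: "\<And>x. norm x = 1 \<Longrightarrow> norm (A *v v) \<le> norm (A *v x)" by auto
  define \<mu> where "\<mu> = norm (A *v v)"
  have low: "\<mu> * norm x \<le> norm (A *v x)" for x
  proof (cases "x = 0")
    case False
    have "\<mu> \<le> norm (A *v ((1 / norm x) *\<^sub>R x))"
      unfolding \<mu>_def by (rule vmin) (use False in simp)
    also have "\<dots> = norm (A *v x) / norm x"
      by (simp add: matrix_vector_mult_scaleR)
    finally show ?thesis using False by (simp add: field_simps)
  qed simp
  have eig: "(transpose A ** A) *v v = \<mu>\<^sup>2 *\<^sub>R v"
  proof -
    define u where "u = (transpose A ** A) *v v - \<mu>\<^sup>2 *\<^sub>R v"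
    define q where "q = (norm (A *v u))\<^sup>2 - \<mu>\<^sup>2 * (norm u)\<^sup>2"
    have adj: "u \<bullet> ((transpose A ** A) *v v) = (A *v u) \<bullet> (A *v v)"
      by (metis dot_lmul_matrix inner_commute matrix_vector_mul_assoc transpose_matrix_vector)
    have uu: "(norm u)\<^sup>2 = (A *v u) \<bullet> (A *v v) - \<mu>\<^sup>2 * (u \<bullet> v)"
      using adj by (metis inner_diff_right inner_scaleR_right power2_norm_eq_inner u_def)
    have nonneg: "0 \<le> (norm (A *v x))\<^sup>2 - \<mu>\<^sup>2 * (norm x)\<^sup>2" for x
      using power_mono[OF low[of x], of 2] by (simp add: \<mu>_def power_mult_distrib)
    have q0: "0 \<le> q" unfolding q_def by (rule nonneg)
    have vary: "0 \<le> 2 * t * (norm u)\<^sup>2 + t\<^sup>2 * q" for t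
    proof -
      have "0 \<le> (norm (A *v (v + t *\<^sub>R u)))\<^sup>2 - \<mu>\<^sup>2 * (norm (v + t *\<^sub>R u))\<^sup>2" by (rule nonneg)
      also have "\<dots> = 2 * t * (norm u)\<^sup>2 + t\<^sup>2 * q"
      proof -
        have 1: "(norm (A *v (v + t *\<^sub>R u)))\<^sup>2
          = \<mu>\<^sup>2 + 2 * t * ((A *v u) \<bullet> (A *v v)) + t\<^sup>2 * (norm (A *v u))\<^sup>2"
          unfolding \<mu>_def matrix_vector_right_distrib matrix_vector_mult_scaleR
            power2_norm_eq_inner
          by (simp add: inner_add_left inner_add_right inner_commute power2_eq_square algebra_simps)
        have 2: "(norm (v + t *\<^sub>R u))\<^sup>2 = 1 + 2 * t * (u \<bullet> v) + t\<^sup>2 * (norm u)\<^sup>2"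
        proof -
          have "v \<bullet> v = 1" using v by (simp add: dot_square_norm)
          then show ?thesis
            unfolding power2_norm_eq_inner
            by (simp add: inner_add_left inner_add_right inner_commute power2_eq_square
                algebra_simps)
        qed
        show ?thesis unfolding 1 2 uu q_def by (simp add: algebra_simps)
      qed
      finally show ?thesis .
    qed
    have "(norm u)\<^sup>2 = 0"
    proof (rule ccontr)
      assume "(norm u)\<^sup>2 \<noteq> 0"
      then have a: "(norm u)\<^sup>2 > 0" by simp
      define a where "a = (norm u)\<^sup>2"
      \<comment> \<open>A step slightly shorter than the minimiser of the quadratic in \<open>vary\<close>; adding 1 keeps the
        denominator positive when \<open>q = 0\<close>.\<close>
      define b where "b = a / (q + 1)"
      have ab: "a = b * (q + 1)" using q0 unfolding b_def by simp
      have "b > 0" using a q0 unfolding a_def b_def by simp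
      then have "0 < b\<^sup>2 * (q + 2)" using q0 by simp
      moreover have "2 * (- b) * a + (- b)\<^sup>2 * q = - (b\<^sup>2 * (q + 2))"
        unfolding ab by (simp add: algebra_simps power2_eq_square)
      ultimately show False using vary[of "- b"] unfolding a_def by linarith
    qed
    then show ?thesis unfolding u_def by simp
  qed
  have "smallest_singular_value A = \<mu>"
    unfolding smallest_singular_value_def
  proof (rule Least_equality)
    show "singular_value A \<mu>"
      unfolding singular_value_def using eig v by (auto simp: \<mu>_def intro!: exI[of _ v])
    fix s assume "singular_value A s"
    then obtain w where s: "0 \<le> s" and w: "w \<noteq> 0" "(transpose A ** A) *v w = s\<^sup>2 *\<^sub>R w"
      unfolding singular_value_def by auto
    have "(norm (A *v w))\<^sup>2 = w \<bullet> ((transpose A ** A) *v w)"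
      by (metis dot_lmul_matrix inner_commute matrix_vector_mul_assoc power2_norm_eq_inner
          transpose_matrix_vector)
    also have "\<dots> = (s * norm w)\<^sup>2"
      using w by (simp add: power_mult_distrib dot_square_norm)
    finally have "norm (A *v w) = s * norm w"
      using s by (simp add: power2_eq_iff_nonneg)
    then show "\<mu> \<le> s" using low[of w] w by simp
  qed
  then show ?thesis using v low unfolding \<mu>_def by blast
qed

lemma smallest_singular_value_le:
  fixes A :: "real^'n::finite^'n"
  shows "smallest_singular_value A * norm x \<le> norm (A *v x)"
proof -
  obtain v where "smallest_singular_value A = norm (A *v v)"
    and "\<forall>x. norm (A *v v) * norm x \<le> norm (A *v x)"
    using smallest_singular_value_attained[of A] by blast
  then show ?thesis by simp
qed

lemma smallest_singular_value_pos:
  fixes A :: "real^'n::finite^'n"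
  assumes "invertible A"
  shows "0 < smallest_singular_value A"
proof -
  obtain v where v: "norm v = 1" "smallest_singular_value A = norm (A *v v)"
    using smallest_singular_value_attained[of A] by blast
  have "v \<noteq> 0" using v by auto
  then have "A *v v \<noteq> 0"
    using assms by (metis invertible_def matrix_vector_mul_assoc matrix_vector_mul_lid
        matrix_vector_mult_0_right)
  then show ?thesis using v by simp
qed

lemma measure_linear_preimage_cball:
  fixes T :: "real^'n::finite^'n"
  assumes "invertible T" "0 \<le> r"
  shows "{x. norm (T *v x) \<le> r} \<in> lmeasurable"
    and "measure lebesgue {x. norm (T *v x) \<le> r}
      = unit_ball_vol (real CARD('n)) * r ^ CARD('n) / \<bar>det T\<bar>"
proof -
  obtain S where S: "S ** T = mat 1" "T ** S = mat 1"
    using assms(1) unfolding invertible_def by blast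
  have eq: "{x. norm (T *v x) \<le> r} = (*v) S ` cball 0 r"
  proof (intro set_eqI iffI)
    fix x assume "x \<in> {x. norm (T *v x) \<le> r}"
    moreover have "x = S *v (T *v x)" using S by (simp add: matrix_vector_mul_assoc)
    ultimately show "x \<in> (*v) S ` cball 0 r" by auto
  next
    fix x assume "x \<in> (*v) S ` cball 0 r"
    then show "x \<in> {x. norm (T *v x) \<le> r}" using S by (auto simp: matrix_vector_mul_assoc)
  qed
  show "{x. norm (T *v x) \<le> r} \<in> lmeasurable"
    unfolding eq using measure_linear_image_finite[OF matrix_vector_mul_linear lmeasurable_cball] by blast
  have "det S * det T = 1" using S by (metis det_I det_mul)
  then have d: "\<bar>det S\<bar> = 1 / \<bar>det T\<bar>"
    by (metis abs_1 abs_mult mult_zero_right nonzero_eq_divide_eq abs_eq_0_iff zero_neq_one)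
  have "measure lebesgue {x. norm (T *v x) \<le> r} = \<bar>det S\<bar> * measure lebesgue (cball 0 r :: (real^'n) set)"
    unfolding eq
    using measure_linear_image_finite[OF matrix_vector_mul_linear lmeasurable_cball, of S 0 r] by simp
  also have "\<dots> = unit_ball_vol (real CARD('n)) * r ^ CARD('n) / \<bar>det T\<bar>"
    using assms(2) by (simp add: d content_cball)
  finally show "measure lebesgue {x. norm (T *v x) \<le> r}
      = unit_ball_vol (real CARD('n)) * r ^ CARD('n) / \<bar>det T\<bar>" .
qed

text \<open>The determinant is the product of all singular values; by volumes, the preimage of the unit
  ball lies in the ball of radius \<open>1 / smallest_singular_value A\<close>.\<close>

lemma smallest_singular_value_power_le_det:
  fixes A :: "real^'n::finite^'n"
  assumes "invertible A"
  shows "smallest_singular_value A ^ CARD('n) \<le> \<bar>det A\<bar>"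
proof -
  let ?s = "smallest_singular_value A" and ?V = "unit_ball_vol (real CARD('n))"
  have s: "0 < ?s" using assms by (rule smallest_singular_value_pos)
  have V: "0 < ?V" by simp
  have D: "0 < \<bar>det A\<bar>" using assms by (simp add: invertible_det_nz)
  have "{x. norm (A *v x) \<le> 1} \<subseteq> cball 0 (1 / ?s)"
  proof
    fix x assume "x \<in> {x. norm (A *v x) \<le> 1}"
    then have "?s * norm x \<le> 1" using smallest_singular_value_le[of A x] by simp
    then show "x \<in> cball 0 (1 / ?s)" using s by (simp add: field_simps)
  qed
  then have "measure lebesgue {x. norm (A *v x) \<le> 1} \<le> measure lebesgue (cball 0 (1 / ?s) :: (real^'n) set)"
    by (intro measure_mono_fmeasurable)
      (use measure_linear_preimage_cball(1)[OF assms, of 1] in \<open>auto dest: fmeasurableD\<close>)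
  then have "?V / \<bar>det A\<bar> \<le> ?V * (1 / ?s) ^ CARD('n)"
    using s by (simp add: measure_linear_preimage_cball(2)[OF assms] content_cball)
  then have "?V * (1 / \<bar>det A\<bar>) \<le> ?V * (1 / ?s ^ CARD('n))"
    by (simp add: power_one_over)
  then have "1 / \<bar>det A\<bar> \<le> 1 / ?s ^ CARD('n)"
    using V by (simp only: mult_le_cancel_left_pos)
  then show ?thesis using s D by (simp add: field_simps)
qed

lemma delta_pos: "invertible (A h) \<Longrightarrow> 0 < delta A h"
  unfolding delta_def by (rule smallest_singular_value_pos)

lemma Delta_pos: "invertible (A h) \<Longrightarrow> 0 < Delta A h"
  unfolding Delta_def by (simp add: invertible_det_nz)

section \<open>Solutions and transition matrices\<close>

primrec transition :: "('m::finite \<Rightarrow> real^'n::finite^'n) \<Rightarrow> (nat \<Rightarrow> 'm) \<Rightarrow> nat \<Rightarrow> real^'n^'n" where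
  "transition A \<sigma> 0 = mat 1"
| "transition A \<sigma> (Suc k) = A (\<sigma> k) ** transition A \<sigma> k"

lemma is_solution_iff_transition:
  "is_solution A x0 x \<longleftrightarrow> (\<exists>\<sigma>. \<forall>k. x k = transition A \<sigma> k *v x0)"
proof
  assume "is_solution A x0 x"
  then obtain \<sigma> where \<sigma>: "x 0 = x0" "\<And>k. x (Suc k) = A (\<sigma> k) *v x k"
    unfolding is_solution_def by auto
  have "x k = transition A \<sigma> k *v x0" for k
    by (induction k) (simp_all add: \<sigma> matrix_vector_mul_assoc)
  then show "\<exists>\<sigma>. \<forall>k. x k = transition A \<sigma> k *v x0" by blast
next
  assume "\<exists>\<sigma>. \<forall>k. x k = transition A \<sigma> k *v x0"
  then obtain \<sigma> where "\<And>k. x k = transition A \<sigma> k *v x0" by blast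
  then show "is_solution A x0 x"
    unfolding is_solution_def by (auto simp: matrix_vector_mul_assoc)
qed

lemma transition_cong: "(\<And>i. i < k \<Longrightarrow> \<sigma> i = \<tau> i) \<Longrightarrow> transition A \<sigma> k = transition A \<tau> k"
  by (induction k) auto

lemma abs_det_transition: "\<bar>det (transition A \<sigma> k)\<bar> = (\<Prod>i<k. Delta A (\<sigma> i))"
  by (induction k) (simp_all add: det_mul abs_mult Delta_def mult.commute)

lemma invertible_transition:
  assumes "\<And>h. invertible (A h)"
  shows "invertible (transition A \<sigma> k)"
  using assms by (induction k) (auto simp: invertible_mult invertible_det_nz det_mul)

lemma norm_transition_ge:
  assumes "\<And>h. invertible (A h)"
  shows "(\<Prod>i<k. delta A (\<sigma> i)) * norm x \<le> norm (transition A \<sigma> k *v x)"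
proof (induction k)
  case (Suc k)
  have "(\<Prod>i<Suc k. delta A (\<sigma> i)) * norm x
      = delta A (\<sigma> k) * ((\<Prod>i<k. delta A (\<sigma> i)) * norm x)" by simp
  also have "\<dots> \<le> delta A (\<sigma> k) * norm (transition A \<sigma> k *v x)"
    using Suc delta_pos[of A "\<sigma> k", OF assms] by (simp add: mult_left_mono)
  also have "\<dots> \<le> norm (A (\<sigma> k) *v (transition A \<sigma> k *v x))"
    unfolding delta_def by (rule smallest_singular_value_le)
  finally show ?case by (simp add: matrix_vector_mul_assoc)
qed simp

section \<open>Lower bounds for the stabilizability radius\<close>

text \<open>The rate \<open>L\<close> is uniform in \<open>x0\<close>, so that the supremum over all initial states in
  \<open>stabilizability_radius\<close> is the supremum of a bounded set. The factor 1 is the constant \<open>M\<close> of that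
  definition.\<close>

lemma solution_upper_bound:
  fixes A :: "'m::finite \<Rightarrow> real^'n::finite^'n"
  shows "\<exists>L\<ge>0. \<forall>x0. \<exists>x. is_solution A x0 x \<and> (\<forall>k. norm (x k) \<le> 1 * L ^ k * norm x0)"
proof -
  fix h :: 'm
  let ?L = "onorm ((*v) (A h))"
  have L: "0 \<le> ?L" by (simp add: onorm_pos_le)
  have "norm (transition A (\<lambda>_. h) k *v x0) \<le> ?L ^ k * norm x0" for x0 k
  proof (induction k)
    case (Suc k)
    have "norm (transition A (\<lambda>_. h) (Suc k) *v x0) \<le> ?L * norm (transition A (\<lambda>_. h) k *v x0)"
      using onorm[OF matrix_vector_mul_bounded_linear, of "A h"]
      by (simp add: matrix_vector_mul_assoc[symmetric])
    also have "\<dots> \<le> ?L * (?L ^ k * norm x0)" using Suc L by (rule mult_left_mono)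
    finally show ?case by simp
  qed simp
  then have "\<forall>k. norm (transition A (\<lambda>_. h) k *v x0) \<le> 1 * ?L ^ k * norm x0" for x0 by simp
  moreover have "is_solution A x0 (\<lambda>k. transition A (\<lambda>_. h) k *v x0)" for x0
    unfolding is_solution_iff_transition by blast
  ultimately show ?thesis using L by blast
qed

text \<open>The only access to the two-level definition of the radius: every rate above it is attained from
  every initial state. The two side conditions, a nonempty set under the infimum and a bounded one
  under the supremum, come from the uniform rate above.\<close>

lemma stabilizability_radius_lessD:
  fixes A :: "'m::finite \<Rightarrow> real^'n::finite^'n"
  assumes "stabilizability_radius A < r"
  shows "\<exists>l x M. 0 \<le> l \<and> l < r \<and> is_solution A x0 x \<and> 0 < M \<and> (\<forall>k. norm (x k) \<le> M * l ^ k * norm x0)"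
proof -
  define X where "X x0 = {l :: real. 0 \<le> l \<and>
       (\<exists>x M. is_solution A x0 x \<and> M > 0 \<and> (\<forall>k. norm (x k) \<le> M * l ^ k * norm x0))}" for x0
  have rad: "stabilizability_radius_at A x0 = Inf (X x0)" for x0
    unfolding X_def stabilizability_radius_at_def ..
  obtain L where L: "0 \<le> L" "\<And>x0. \<exists>x. is_solution A x0 x \<and> (\<forall>k. norm (x k) \<le> 1 * L ^ k * norm x0)"
    using solution_upper_bound[of A] by blast
  have LX: "L \<in> X x0" for x0 unfolding X_def using L(1) L(2)[of x0] zero_less_one by blast
  have bdd: "bdd_below (X x0)" for x0 unfolding X_def by (rule bdd_belowI[of _ 0]) auto
  have "Inf (X x0) \<le> L" for x0 by (rule cInf_lower[OF LX bdd])
  then have "bdd_above (range (stabilizability_radius_at A))"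
    unfolding rad[abs_def] by (auto intro!: bdd_aboveI[of _ L])
  then have "stabilizability_radius_at A x0 \<le> stabilizability_radius A"
    unfolding stabilizability_radius_def by (rule cSUP_upper[OF UNIV_I])
  then have "Inf (X x0) < r" using assms rad by simp
  then have "\<exists>l\<in>X x0. l < r" using LX by (intro cInf_lessD) auto
  then show ?thesis unfolding X_def by auto
qed

lemma stabilizability_radius_ge_Min_delta:
  fixes A :: "'m::finite \<Rightarrow> real^'n::finite^'n"
  assumes inv: "\<And>h. invertible (A h)"
  shows "(MIN h. delta A h) \<le> stabilizability_radius A"
proof (rule ccontr)
  let ?d = "MIN h. delta A h"
  assume "\<not> ?d \<le> stabilizability_radius A"
  then have "stabilizability_radius A < ?d" by (simp only: not_le)
  from stabilizability_radius_lessD[OF this, of "axis undefined 1"]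
  obtain l x M where l: "0 \<le> l" "l < ?d" and sol: "is_solution A (axis undefined 1) x"
    and M: "0 < M" "\<And>k. norm (x k) \<le> M * l ^ k" by auto
  obtain \<sigma> where \<sigma>: "\<And>k. x k = transition A \<sigma> k *v (axis undefined 1)"
    using sol unfolding is_solution_iff_transition by blast
  have d: "0 < ?d" using l by (rule le_less_trans)
  have "?d ^ k \<le> M * l ^ k" for k
  proof -
    have "?d ^ k = (\<Prod>i<k. ?d)" by simp
    also have "\<dots> \<le> (\<Prod>i<k. delta A (\<sigma> i))" by (intro prod_mono conjI less_imp_le[OF d] Min_le) auto
    also have "\<dots> \<le> norm (x k)"
      using norm_transition_ge[of A, OF inv, where \<sigma> = \<sigma> and k = k and x = "axis undefined 1"] by (simp add: \<sigma>)
    finally show ?thesis using M(2)[of k] by simp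
  qed
  then have "1 \<le> M * (l / ?d) ^ k" for k
    using d by (simp add: power_divide field_simps)
  moreover have "(\<lambda>k. M * (l / ?d) ^ k) \<longlonglongrightarrow> M * 0"
  proof (intro tendsto_mult tendsto_const LIMSEQ_power_zero)
    have "l / ?d < 1" using l(2) d by (simp only: divide_less_eq_1_pos)
    then show "norm (l / ?d) < 1" using divide_nonneg_pos[OF l(1) d] by (simp only: real_norm_def abs_of_nonneg)
  qed
  ultimately show False using LIMSEQ_le_const[of _ "M * 0" 1] by fastforce
qed
text \<open>The normalising constant of \<open>nu_hat A UNIV \<beta>\<close>, named as in statistical mechanics.\<close>

definition partition_sum :: "('m::finite \<Rightarrow> real^'n::finite^'n) \<Rightarrow> real \<Rightarrow> real" where
  "partition_sum A \<beta> = (\<Sum>h\<in>UNIV. delta A h powr \<beta> * inverse (Delta A h))"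

lemma weight_pos:
  assumes "\<And>h. invertible (A h)"
  shows "0 < delta A h powr \<beta> * inverse (Delta A h)"
  using delta_pos[of A h, OF assms] Delta_pos[of A h, OF assms] by simp

lemma partition_sum_pos:
  assumes "\<And>h. invertible (A h)"
  shows "0 < partition_sum A \<beta>"
  unfolding partition_sum_def using weight_pos[of A, OF assms] by (intro sum_pos) auto

text \<open>Summed over all words of length \<open>k\<close>, the weights are the terms of an expanded \<open>k\<close>-th power.\<close>

lemma sum_words_weight:
  assumes "\<And>h. invertible (A h)"
  shows "(\<Sum>w\<in>PiE {..<k} (\<lambda>_. UNIV). (\<Prod>i<k. delta A (w i)) powr \<beta> / (\<Prod>i<k. Delta A (w i)))
    = partition_sum A \<beta> ^ k"
proof -
  have "(\<Prod>i<k. delta A (w i)) powr \<beta> / (\<Prod>i<k. Delta A (w i))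
      = (\<Prod>i<k. delta A (w i) powr \<beta> * inverse (Delta A (w i)))" for w
    unfolding prod.distrib divide_inverse prod_inversef[unfolded o_def]
    by (simp only: prod_powr_distrib)
  moreover have "partition_sum A \<beta> ^ k
      = (\<Prod>i<k. \<Sum>h\<in>UNIV. delta A h powr \<beta> * inverse (Delta A h))"
    unfolding partition_sum_def by simp
  ultimately show ?thesis
    using prod_sum_PiE[of "{..<k}" "\<lambda>_. UNIV" "\<lambda>_ h. delta A h powr \<beta> * inverse (Delta A h)"]
    by simp
qed

text \<open>An initial state outside the unit ball that some solution sends below \<open>N * l ^ i\<close> at all times
  is, at time \<open>k\<close>, in the preimage of a ball under the transition matrix of some word, and the
  product of the \<open>\<delta>\<close>s along this word is at most \<open>N * l ^ k\<close>. As \<open>\<beta> \<le> 0\<close>, inserting the factor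
  \<open>((\<Prod>\<delta>) / (N * l ^ k)) powr \<beta> \<ge> 1\<close> only increases the volume of the preimages of such words, and
  afterwards the sum may run over all words.\<close>

lemma negligible_stable_states:
  fixes A :: "'m::finite \<Rightarrow> real^'n::finite^'n"
  assumes inv: "\<And>h. invertible (A h)" and "\<beta> \<le> 0" "0 < l" "0 < N"
    and small: "l powr (real CARD('n) - \<beta>) * partition_sum A \<beta> < 1"
  shows "negligible {x0. 1 \<le> norm x0 \<and> (\<exists>x. is_solution A x0 x \<and> (\<forall>k. norm (x k) \<le> N * l ^ k))}"
    (is "negligible ?C")
  unfolding negligible_outer_le
proof (intro allI impI)
  fix e :: real assume e: "0 < e"
  let ?n = "CARD('n)" and ?V = "unit_ball_vol (real CARD('n))" and ?Z = "partition_sum A \<beta>"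
  have Z: "0 < ?Z" using inv by (rule partition_sum_pos)
  define q where "q = l powr (real ?n - \<beta>) * ?Z"
  have q: "0 \<le> q" "q < 1" using small Z by (auto simp: q_def)
  define K where "K = ?V * N powr (real ?n - \<beta>)"
  have "(\<lambda>k. K * q ^ k) \<longlonglongrightarrow> K * 0"
    using q by (intro tendsto_mult tendsto_const LIMSEQ_power_zero) auto
  then have "eventually (\<lambda>k. K * q ^ k < e) sequentially"
    using e order_tendstoD(2) by fastforce
  then obtain k where k: "K * q ^ k < e" by (auto simp: eventually_sequentially)
  define R where "R = N * l ^ k"
  have R: "0 < R" unfolding R_def using assms by simp
  define W where "W = {w \<in> PiE {..<k} (\<lambda>_. UNIV). (\<Prod>i<k. delta A (w i)) \<le> R}"
  define E where "E w = {x. norm (transition A w k *v x) \<le> R}" for w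
  have finP: "finite (PiE {..<k} (\<lambda>_. UNIV :: 'm set))" by (rule finite_PiE) auto
  then have finW: "finite W" unfolding W_def by (rule rev_finite_subset) auto
  have invT: "invertible (transition A w k)" for w using inv by (rule invertible_transition)
  have E_meas: "E w \<in> lmeasurable" for w
    unfolding E_def using measure_linear_preimage_cball(1)[OF invT] R by simp
  have dpos: "0 < (\<Prod>i<k. delta A (w i))" for w
    using delta_pos[of A, OF inv] by (intro prod_pos) auto
  have Dpos: "0 < (\<Prod>i<k. Delta A (w i))" for w
    using Delta_pos[of A, OF inv] by (intro prod_pos) auto
  have "?C \<subseteq> (\<Union>w\<in>W. E w)"
  proof
    fix x0 assume "x0 \<in> ?C"
    then obtain \<sigma> where x0: "1 \<le> norm x0" and \<sigma>: "norm (transition A \<sigma> k *v x0) \<le> R"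
      unfolding is_solution_iff_transition R_def by force
    define w where "w = restrict \<sigma> {..<k}"
    have w: "transition A w k = transition A \<sigma> k" by (rule transition_cong) (simp add: w_def)
    have "(\<Prod>i<k. delta A (w i)) * 1 \<le> (\<Prod>i<k. delta A (w i)) * norm x0"
      using x0 dpos[of w] by (intro mult_left_mono) auto
    also have "\<dots> \<le> R" using norm_transition_ge[of A, OF inv, where \<sigma> = w and k = k and x = x0] \<sigma> w by simp
    finally have "w \<in> W" unfolding W_def by (auto simp: w_def)
    moreover have "x0 \<in> E w" using \<sigma> w by (simp add: E_def)
    ultimately show "x0 \<in> (\<Union>w\<in>W. E w)" by blast
  qed
  moreover have "(\<Union>w\<in>W. E w) \<in> lmeasurable" using finW E_meas by (intro fmeasurable.finite_UN) auto
  moreover have "measure lebesgue (\<Union>w\<in>W. E w) \<le> e"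
  proof -
    have "measure lebesgue (\<Union>w\<in>W. E w) \<le> (\<Sum>w\<in>W. measure lebesgue (E w))"
      using finW E_meas by (intro measure_UNION_le) auto
    also have "\<dots> \<le> (\<Sum>w\<in>W. ?V * R powr (real ?n - \<beta>) *
        ((\<Prod>i<k. delta A (w i)) powr \<beta> / (\<Prod>i<k. Delta A (w i))))"
    proof (rule sum_mono)
      fix w assume "w \<in> W"
      then have "(\<Prod>i<k. delta A (w i)) \<le> R" unfolding W_def by simp
      then have "R powr \<beta> \<le> (\<Prod>i<k. delta A (w i)) powr \<beta>"
        using dpos assms(2) by (intro powr_mono2') auto
      then have "R powr (real ?n - \<beta>) * R powr \<beta> \<le> R powr (real ?n - \<beta>) * (\<Prod>i<k. delta A (w i)) powr \<beta>"
        by (intro mult_left_mono) auto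
      then have *: "R ^ ?n \<le> R powr (real ?n - \<beta>) * (\<Prod>i<k. delta A (w i)) powr \<beta>"
        using R by (simp add: powr_add[symmetric] powr_realpow)
      have "measure lebesgue (E w) = ?V * R ^ ?n / (\<Prod>i<k. Delta A (w i))"
        unfolding E_def
        using measure_linear_preimage_cball(2)[OF invT] R
        by (simp add: abs_det_transition)
      also have "\<dots> \<le> ?V * (R powr (real ?n - \<beta>) * (\<Prod>i<k. delta A (w i)) powr \<beta>) / (\<Prod>i<k. Delta A (w i))"
        using * Dpos[of w] by (intro divide_right_mono mult_left_mono) auto
      finally show "measure lebesgue (E w) \<le> ?V * R powr (real ?n - \<beta>) *
        ((\<Prod>i<k. delta A (w i)) powr \<beta> / (\<Prod>i<k. Delta A (w i)))" by simp
    qed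
    also have "\<dots> \<le> (\<Sum>w\<in>PiE {..<k} (\<lambda>_. UNIV). ?V * R powr (real ?n - \<beta>) *
        ((\<Prod>i<k. delta A (w i)) powr \<beta> / (\<Prod>i<k. Delta A (w i))))"
      using less_imp_le[OF Dpos] by (intro sum_mono2 finP)
        (auto simp: W_def intro!: mult_nonneg_nonneg divide_nonneg_nonneg)
    also have "\<dots> = ?V * R powr (real ?n - \<beta>) * ?Z ^ k"
      by (simp only: sum_distrib_left[symmetric] sum_words_weight[OF inv])
    also have "R powr (real ?n - \<beta>) = N powr (real ?n - \<beta>) * (l powr (real ?n - \<beta>)) ^ k"
      unfolding R_def using assms(3,4)
      by (simp add: powr_mult powr_realpow[symmetric] powr_powr mult.commute)
    finally have "measure lebesgue (\<Union>w\<in>W. E w) \<le> K * q ^ k"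
      by (simp add: K_def q_def power_mult_distrib mult.assoc)
    then show ?thesis using k by simp
  qed
  ultimately show "\<exists>T. ?C \<subseteq> T \<and> T \<in> lmeasurable \<and> measure lebesgue T \<le> e" by blast
qed

text \<open>If the radius were smaller, every initial state outside the unit ball would lie in one of
  countably many negligible sets. This uses one solution for each initial state, with no
  uniformity in the constants.\<close>

lemma stabilizability_radius_ge_partition_sum:
  fixes A :: "'m::finite \<Rightarrow> real^'n::finite^'n"
  assumes inv: "\<And>h. invertible (A h)" and "\<beta> \<le> 0"
  shows "partition_sum A \<beta> powr (- 1 / (real CARD('n) - \<beta>)) \<le> stabilizability_radius A"
proof (rule ccontr)
  let ?n = "real CARD('n)" and ?Z = "partition_sum A \<beta>"
  assume "\<not> ?thesis"
  then obtain l where l: "stabilizability_radius A < l" "l < ?Z powr (- 1 / (?n - \<beta>))"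
    using dense by (metis not_le)
  have n: "0 < ?n - \<beta>" using assms(2) zero_less_card_finite[where 'a = 'n] by linarith
  have Z: "0 < ?Z" using inv by (rule partition_sum_pos)
  have lpos: "0 < l" using stabilizability_radius_lessD[OF l(1)] by force
  have "l powr (?n - \<beta>) < (?Z powr (- 1 / (?n - \<beta>))) powr (?n - \<beta>)"
    using l(2) lpos n by (intro powr_less_mono2) auto
  also have "\<dots> = ?Z powr (- 1)" unfolding powr_powr using n by simp
  also have "\<dots> = 1 / ?Z" using Z by (simp add: powr_minus_divide)
  finally have small: "l powr (?n - \<beta>) * ?Z < 1" using Z by (simp add: field_simps)
  define C where "C N = {x0. 1 \<le> norm x0 \<and> (\<exists>x. is_solution A x0 x \<and> (\<forall>k. norm (x k) \<le> real (Suc N) * l ^ k))}"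
    for N
  have "negligible (\<Union>N. C N)"
    unfolding C_def
    using negligible_stable_states[OF inv assms(2) lpos _ small] by (intro negligible_Union_nat) auto
  moreover have "- cball 0 1 \<subseteq> (\<Union>N. C N)"
  proof
    fix x0 :: "real^'n" assume x0: "x0 \<in> - cball 0 1"
    obtain l' x M where *: "0 \<le> l'" "l' < l" "is_solution A x0 x" "0 < M"
      "\<And>k. norm (x k) \<le> M * l' ^ k * norm x0"
      using stabilizability_radius_lessD[OF l(1), of x0] by blast
    obtain N where N: "M * norm x0 \<le> real N" using real_arch_simple by blast
    have "norm (x k) \<le> real (Suc N) * l ^ k" for k
    proof -
      have "norm (x k) \<le> (M * norm x0) * l' ^ k" using *(5)[of k] by (simp add: mult_ac)
      also have "\<dots> \<le> real (Suc N) * l ^ k"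
        using N *(1,2,4) by (intro mult_mono power_mono) auto
      finally show ?thesis .
    qed
    then show "x0 \<in> (\<Union>N. C N)" unfolding C_def using x0 *(3) by auto
  qed
  ultimately have "negligible (- cball (0 :: real^'n) 1)" by (rule negligible_subset)
  moreover have "- cball (0 :: real^'n) 1 \<noteq> {}"
    by (metis bounded_cball compl_bot_eq double_compl not_bounded_UNIV)
  moreover have "open (- cball (0 :: real^'n) 1)" by (simp add: open_Compl)
  ultimately show False using open_not_negligible by blast
qed

section \<open>Relative entropy and the tilted distributions\<close>

definition relative_entropy :: "real^'m::finite \<Rightarrow> real^'m \<Rightarrow> real" where
  "relative_entropy \<nu> p = (\<Sum>h\<in>UNIV. \<nu> $ h * ln (\<nu> $ h / p $ h))"

text \<open>Gibbs' inequality, from \<open>ln t \<le> t - 1\<close> at \<open>t = p $ h / \<nu> $ h\<close>, where equality forces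
  \<open>t = 1\<close>.\<close>

lemma relative_entropy_ge:
  fixes \<nu> p :: "real^'m::finite"
  assumes \<nu>: "\<nu> \<in> prob_simplex" and p: "p \<in> prob_simplex" "\<And>h. 0 < p $ h"
  shows "0 \<le> relative_entropy \<nu> p" and "\<nu> \<noteq> p \<Longrightarrow> 0 < relative_entropy \<nu> p"
proof -
  define g where "g h = \<nu> $ h * ln (\<nu> $ h / p $ h) - (\<nu> $ h - p $ h)" for h
  have nn: "0 \<le> \<nu> $ h" for h using \<nu> by (simp add: prob_simplex_def)
  have g: "0 \<le> g h \<and> (g h = 0 \<longrightarrow> \<nu> $ h = p $ h)" for h
  proof (cases "\<nu> $ h = 0")
    case True
    then show ?thesis using p(2)[of h] by (simp add: g_def)
  next
    case False
    then have pos: "0 < \<nu> $ h" using nn[of h] by simp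
    define t where "t = p $ h / \<nu> $ h"
    have t: "0 < t" unfolding t_def using pos p(2)[of h] by simp
    have "ln (\<nu> $ h / p $ h) = - ln t"
      unfolding t_def using pos p(2)[of h] by (simp add: ln_div)
    moreover have "p $ h = \<nu> $ h * t" unfolding t_def using pos by simp
    ultimately have eq: "g h = \<nu> $ h * (t - 1 - ln t)" by (simp add: g_def algebra_simps)
    have "0 \<le> g h" unfolding eq using nn ln_le_minus_one[OF t] by simp
    moreover have "\<nu> $ h = p $ h" if "g h = 0"
    proof -
      have "ln t = t - 1" using that pos unfolding eq by simp
      then have "t = 1" by (rule ln_eq_minus_one[OF t])
      then show ?thesis using pos by (simp add: t_def)
    qed
    ultimately show ?thesis by blast
  qed
  have sum: "relative_entropy \<nu> p = (\<Sum>h\<in>UNIV. g h)"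
    using \<nu> p(1) by (simp add: relative_entropy_def g_def sum_subtractf prob_simplex_def)
  show "0 \<le> relative_entropy \<nu> p" unfolding sum using g by (simp add: sum_nonneg)
  assume "\<nu> \<noteq> p"
  then obtain h where "\<nu> $ h \<noteq> p $ h" by (auto simp: vec_eq_iff)
  then have "0 < g h" using g[of h] by force
  then show "0 < relative_entropy \<nu> p"
    unfolding sum using g by (intro sum_pos2[of UNIV h]) auto
qed

lemma delta_prod_eq_exp:
  assumes "\<And>h. invertible (A h)"
  shows "delta_prod A \<nu> = exp (\<Sum>h\<in>UNIV. \<nu> $ h * ln (delta A h))"
proof -
  have "delta A h powr (\<nu> $ h) = exp (\<nu> $ h * ln (delta A h))" for h
    using delta_pos[of A h, OF assms] by (simp add: powr_def)
  then show ?thesis unfolding delta_prod_def by (simp add: exp_sum)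
qed

lemma nu_hat_sum_pos:
  assumes "\<And>h. invertible (A h)" "S \<noteq> {}"
  shows "0 < (\<Sum>j\<in>S. delta A j powr \<beta> * inverse (Delta A j))"
  using weight_pos[of A, OF assms(1)] assms(2) by (intro sum_pos) auto

lemma nu_hat_in_prob_simplex:
  fixes A :: "'m::finite \<Rightarrow> real^'n::finite^'n"
  assumes inv: "\<And>h. invertible (A h)" and "S \<noteq> {}"
  shows "nu_hat A S \<beta> \<in> prob_simplex"
proof -
  let ?w = "\<lambda>j. delta A j powr \<beta> * inverse (Delta A j)"
  have Z: "0 < sum ?w S" using assms by (rule nu_hat_sum_pos)
  have w: "0 \<le> ?w h" for h using Delta_pos[of A h, OF inv] by simp
  have le: "?w h \<le> sum ?w S" if "h \<in> S" for h
    using that w by (intro member_le_sum) auto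
  have "(\<Sum>h\<in>UNIV. nu_hat A S \<beta> $ h) = (\<Sum>h\<in>S. ?w h / sum ?w S)"
    by (simp add: nu_hat_def sum.If_cases)
  also have "\<dots> = 1" using Z by (simp add: sum_divide_distrib[symmetric])
  finally show ?thesis
    using w le Z by (auto simp: prob_simplex_def nu_hat_def divide_nonneg_pos)
qed

lemma nu_hat_UNIV_nth:
  "nu_hat A UNIV \<beta> $ h = delta A h powr \<beta> * inverse (Delta A h) / partition_sum A \<beta>"
  by (simp add: nu_hat_def partition_sum_def)

lemma nu_hat_UNIV_pos:
  assumes "\<And>h. invertible (A h)"
  shows "0 < nu_hat A UNIV \<beta> $ h"
  using delta_pos[of A h, OF assms] Delta_pos[of A h, OF assms] partition_sum_pos[of A \<beta>, OF assms]
  by (simp add: nu_hat_UNIV_nth)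

lemma nu_bar_eq_nu_hat:
  assumes "\<And>h. invertible (A h)"
  shows "nu_bar A = nu_hat A UNIV 0"
proof -
  have "delta A h powr 0 = 1" for h using delta_pos[of A h, OF assms] by simp
  then show ?thesis by (simp add: nu_bar_def nu_hat_def)
qed

text \<open>The relation on which everything rests: up to a multiple of \<open>ln (delta_prod A \<nu>)\<close> and a
  constant, \<open>Psi\<close> is the relative entropy with respect to any of the tilted distributions.
  On a level set of \<open>Psi\<close>, for \<open>\<beta> < CARD('n)\<close>, minimising \<open>delta_prod\<close> thus means minimising the
  relative entropy.\<close>

lemma Psi_eq_relative_entropy:
  fixes A :: "'m::finite \<Rightarrow> real^'n::finite^'n"
  assumes inv: "\<And>h. invertible (A h)" and \<nu>: "\<nu> \<in> prob_simplex"
  shows "Psi A \<nu> = relative_entropy \<nu> (nu_hat A UNIV \<beta>)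
    - (real CARD('n) - \<beta>) * ln (delta_prod A \<nu>) - ln (partition_sum A \<beta>)"
proof -
  let ?n = "real CARD('n)" and ?Z = "partition_sum A \<beta>"
  have Z: "0 < ?Z" using inv by (rule partition_sum_pos)
  have one: "(\<Sum>h\<in>UNIV. \<nu> $ h) = 1" using \<nu> by (simp add: prob_simplex_def)
  have "\<nu> $ h * ln (\<nu> $ h * Delta A h / delta A h ^ CARD('n))
      = \<nu> $ h * ln (\<nu> $ h / nu_hat A UNIV \<beta> $ h)
        - (?n - \<beta>) * (\<nu> $ h * ln (delta A h)) - \<nu> $ h * ln ?Z" for h
  proof (cases "\<nu> $ h = 0")
    case False
    then have pos: "0 < \<nu> $ h" using \<nu> by (simp add: prob_simplex_def order.strict_iff_order)
    have d: "0 < delta A h" and D: "0 < Delta A h"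
      using delta_pos[of A h, OF inv] Delta_pos[of A h, OF inv] by auto
    have "ln (\<nu> $ h * Delta A h / delta A h ^ CARD('n))
        = ln (\<nu> $ h) + ln (Delta A h) - ?n * ln (delta A h)"
      using pos d D by (simp add: ln_div ln_mult ln_realpow)
    moreover have "ln (\<nu> $ h / nu_hat A UNIV \<beta> $ h)
        = ln (\<nu> $ h) - (\<beta> * ln (delta A h) - ln (Delta A h) - ln ?Z)"
      using pos d D Z by (simp add: nu_hat_UNIV_nth ln_div ln_mult ln_inverse ln_powr)
    ultimately show ?thesis by (simp only:) (simp add: algebra_simps)
  qed simp
  then show ?thesis
    unfolding Psi_def relative_entropy_def delta_prod_eq_exp[of A, OF inv] ln_exp
    by (simp add: sum_subtractf sum_distrib_left[symmetric] sum_distrib_right[symmetric] one)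
qed

lemma delta_prod_pos:
  assumes "\<And>h. invertible (A h)"
  shows "0 < delta_prod A \<nu>"
  by (simp add: delta_prod_eq_exp[of A, OF assms])

text \<open>At a zero of \<open>Psi\<close> on the curve of tilted distributions, \<open>delta_prod\<close> agrees with the lower bound
  that the covering argument gives for the radius at the same \<open>\<beta>\<close>.\<close>

lemma delta_prod_nu_hat:
  fixes A :: "'m::finite \<Rightarrow> real^'n::finite^'n"
  assumes inv: "\<And>h. invertible (A h)" and "\<beta> < real CARD('n)" "Psi A (nu_hat A UNIV \<beta>) = 0"
  shows "delta_prod A (nu_hat A UNIV \<beta>) = partition_sum A \<beta> powr (- 1 / (real CARD('n) - \<beta>))"
proof -
  have "nu_hat A UNIV \<beta> \<in> prob_simplex" using inv by (rule nu_hat_in_prob_simplex) simp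
  moreover have "relative_entropy p p = 0" for p :: "real^'m"
    unfolding relative_entropy_def by (rule sum.neutral) auto
  ultimately have "(real CARD('n) - \<beta>) * ln (delta_prod A (nu_hat A UNIV \<beta>)) = - ln (partition_sum A \<beta>)"
    using Psi_eq_relative_entropy[of A "nu_hat A UNIV \<beta>" \<beta>, OF inv] assms(3) by simp
  then have "ln (delta_prod A (nu_hat A UNIV \<beta>)) = - 1 / (real CARD('n) - \<beta>) * ln (partition_sum A \<beta>)"
    using assms(2) by (simp add: field_simps)
  then show ?thesis
    using delta_prod_pos[of A, OF inv] partition_sum_pos[of A \<beta>, OF inv]
    by (metis exp_ln less_irrefl powr_def)
qed

lemma nu_hat_strict_minimizer:
  fixes A :: "'m::finite \<Rightarrow> real^'n::finite^'n"
  assumes inv: "\<And>h. invertible (A h)" and \<beta>: "\<beta> < real CARD('n)" "Psi A (nu_hat A UNIV \<beta>) = 0"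
    and \<nu>: "\<nu> \<in> Psi_zeros A" "\<nu> \<noteq> nu_hat A UNIV \<beta>"
  shows "delta_prod A (nu_hat A UNIV \<beta>) < delta_prod A \<nu>"
proof -
  let ?p = "nu_hat A UNIV \<beta>"
  have p: "?p \<in> prob_simplex" using inv by (rule nu_hat_in_prob_simplex) simp
  have \<nu>': "\<nu> \<in> prob_simplex" "Psi A \<nu> = 0" using \<nu>(1) by (auto simp: Psi_zeros_def)
  have "0 < relative_entropy \<nu> ?p"
    using relative_entropy_ge(2)[OF \<nu>'(1) p nu_hat_UNIV_pos[of A, OF inv]] \<nu>(2) by simp
  moreover have "relative_entropy ?p ?p = 0"
    unfolding relative_entropy_def by (rule sum.neutral) auto
  ultimately have "(real CARD('n) - \<beta>) * ln (delta_prod A ?p) < (real CARD('n) - \<beta>) * ln (delta_prod A \<nu>)"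
    using Psi_eq_relative_entropy[of A \<nu> \<beta>, OF inv \<nu>'(1)] \<nu>'(2)
      Psi_eq_relative_entropy[of A ?p \<beta>, OF inv p] \<beta>(2) by linarith
  then have "ln (delta_prod A ?p) < ln (delta_prod A \<nu>)" using \<beta>(1) by simp
  then show ?thesis using delta_prod_pos[of A, OF inv] by simp
qed

lemma rho_minus_eq_partition_sum:
  fixes A :: "'m::finite \<Rightarrow> real^'n::finite^'n"
  assumes "\<And>h. invertible (A h)"
  shows "rho_minus A = partition_sum A 0 powr (- 1 / real CARD('n))"
proof -
  have "delta A h powr 0 = 1" for h using delta_pos[of A h, OF assms] by simp
  then show ?thesis by (simp add: rho_minus_def partition_sum_def)
qed

lemma Psi_eq_relative_entropy_nu_bar:
  fixes A :: "'m::finite \<Rightarrow> real^'n::finite^'n"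
  assumes inv: "\<And>h. invertible (A h)" and \<nu>: "\<nu> \<in> prob_simplex"
  shows "Psi A \<nu> = relative_entropy \<nu> (nu_bar A)
    + real CARD('n) * (ln (rho_minus A) - ln (delta_prod A \<nu>))"
proof -
  have "ln (rho_minus A) = - 1 / real CARD('n) * ln (partition_sum A 0)"
    unfolding rho_minus_eq_partition_sum[of A, OF inv]
    using partition_sum_pos[of A 0, OF inv] by (simp add: ln_powr)
  then show ?thesis
    using Psi_eq_relative_entropy[of A \<nu> 0, OF inv \<nu>]
    unfolding nu_bar_eq_nu_hat[of A, OF inv] by (simp add: algebra_simps)
qed

lemma rho_minus_pos:
  assumes "\<And>h. invertible (A h)"
  shows "0 < rho_minus A"
  unfolding rho_minus_eq_partition_sum[of A, OF assms] using partition_sum_pos[of A 0, OF assms] by simp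

lemma nu_bar_props:
  assumes "\<And>h. invertible (A h)"
  shows "nu_bar A \<in> prob_simplex" "0 < nu_bar A $ h"
  using nu_hat_in_prob_simplex[of A UNIV 0, OF assms] nu_hat_UNIV_pos[of A 0, OF assms]
  by (simp_all add: nu_bar_eq_nu_hat[of A, OF assms])

lemma delta_prod_nu_bar_le_rho_minus:
  fixes A :: "'m::finite \<Rightarrow> real^'n::finite^'n"
  assumes inv: "\<And>h. invertible (A h)" and "0 \<le> Psi A (nu_bar A)"
  shows "delta_prod A (nu_bar A) \<le> rho_minus A"
proof -
  have "relative_entropy (nu_bar A) (nu_bar A) = 0"
    unfolding relative_entropy_def by (rule sum.neutral) auto
  then have "0 \<le> real CARD('n) * (ln (rho_minus A) - ln (delta_prod A (nu_bar A)))"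
    using Psi_eq_relative_entropy_nu_bar[of A, OF inv nu_bar_props(1)[of A, OF inv]] assms(2) by simp
  then have "ln (delta_prod A (nu_bar A)) \<le> ln (rho_minus A)"
    by (simp add: zero_le_mult_iff)
  then show ?thesis using delta_prod_pos[of A, OF inv] rho_minus_pos[of A, OF inv] by simp
qed

text \<open>The inequality is strict because a zero of \<open>Psi\<close> differs from \<open>nu_bar\<close>, so that its relative
  entropy with respect to \<open>nu_bar\<close> is positive.\<close>

lemma rho_minus_less_delta_prod:
  fixes A :: "'m::finite \<Rightarrow> real^'n::finite^'n"
  assumes inv: "\<And>h. invertible (A h)" and "Psi A (nu_bar A) < 0" and \<nu>: "\<nu> \<in> Psi_zeros A"
  shows "rho_minus A < delta_prod A \<nu>"
proof -
  have \<nu>': "\<nu> \<in> prob_simplex" "Psi A \<nu> = 0" "\<nu> \<noteq> nu_bar A"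
    using \<nu> assms(2) by (auto simp: Psi_zeros_def)
  have "0 < relative_entropy \<nu> (nu_bar A)"
    using relative_entropy_ge(2)[OF \<nu>'(1) nu_bar_props[of A, OF inv]] \<nu>'(3) by simp
  then have "0 < real CARD('n) * (ln (delta_prod A \<nu>) - ln (rho_minus A))"
    using Psi_eq_relative_entropy_nu_bar[of A \<nu>, OF inv \<nu>'(1)] \<nu>'(2) by (simp add: algebra_simps)
  then have "ln (rho_minus A) < ln (delta_prod A \<nu>)" by (simp add: zero_less_mult_iff)
  then show ?thesis using delta_prod_pos[of A, OF inv] rho_minus_pos[of A, OF inv] by simp
qed

section \<open>Distributions on the matrices with the smallest singular value\<close>

lemma Min_delta_attained: "\<exists>h. delta A h = (MIN j. delta A j)"
proof -
  have "(MIN j. delta A j) \<in> range (delta A)" by (rule Min_in) auto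
  then show ?thesis by (metis rangeE)
qed

lemma Min_delta_pos:
  assumes "\<And>h. invertible (A h)"
  shows "0 < (MIN h. delta A h)"
  using delta_pos[of A, OF assms] by simp

text \<open>\<open>delta_prod\<close> is a weighted geometric mean of the \<open>\<delta>\<close>s, hence minimal exactly on the face where
  all the weight sits on the smallest ones.\<close>

lemma Min_delta_le_delta_prod:
  fixes A :: "'m::finite \<Rightarrow> real^'n::finite^'n"
  assumes inv: "\<And>h. invertible (A h)" and \<nu>: "\<nu> \<in> prob_simplex"
  shows "(MIN h. delta A h) \<le> delta_prod A \<nu>"
    and "delta_prod A \<nu> = (MIN h. delta A h) \<longleftrightarrow> (\<forall>h. \<nu> $ h \<noteq> 0 \<longrightarrow> delta A h = (MIN h. delta A h))"
proof -
  define d where "d = (MIN h. delta A h)"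
  have d: "0 < d" unfolding d_def using inv by (rule Min_delta_pos)
  have dle: "d \<le> delta A h" for h unfolding d_def by simp
  define g where "g h = \<nu> $ h * (ln (delta A h) - ln d)" for h
  have g: "0 \<le> g h" for h
    using \<nu> d dle[of h] by (auto simp: g_def prob_simplex_def intro!: mult_nonneg_nonneg)
  have "(\<Sum>h\<in>UNIV. \<nu> $ h * ln (delta A h)) = ln d + sum g UNIV"
    using \<nu> by (simp add: g_def prob_simplex_def right_diff_distrib sum_subtractf
        sum_distrib_right[symmetric])
  then have eq: "delta_prod A \<nu> = d * exp (sum g UNIV)"
    using d by (simp add: delta_prod_eq_exp[of A, OF inv] exp_add)
  have "0 \<le> sum g UNIV" using g by (simp add: sum_nonneg)
  then show "d \<le> delta_prod A \<nu>" unfolding eq using d by simp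
  have "delta_prod A \<nu> = d \<longleftrightarrow> (\<forall>h. g h = 0)"
    unfolding eq using d g by (simp add: sum_nonneg_eq_0_iff)
  also have "\<dots> \<longleftrightarrow> (\<forall>h. \<nu> $ h \<noteq> 0 \<longrightarrow> delta A h = d)"
    using d dle delta_pos[of A, OF inv] by (auto simp: g_def)
  finally show "delta_prod A \<nu> = d \<longleftrightarrow> (\<forall>h. \<nu> $ h \<noteq> 0 \<longrightarrow> delta A h = d)" .
qed

lemma Psi_vertex_nonneg:
  fixes A :: "'m::finite \<Rightarrow> real^'n::finite^'n"
  assumes "invertible (A h)"
  shows "0 \<le> Psi A (axis h 1)"
proof -
  have "Psi A (axis h 1) = (\<Sum>j\<in>UNIV. if j = h then ln (Delta A h / delta A h ^ CARD('n)) else 0)"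
    unfolding Psi_def by (rule sum.cong) (auto simp: axis_def)
  also have "\<dots> = ln (Delta A h / delta A h ^ CARD('n))" by simp
  also have "\<dots> \<ge> 0"
    using smallest_singular_value_power_le_det[OF assms] delta_pos[of A h, OF assms]
    by (simp add: delta_def Delta_def)
  finally show ?thesis .
qed

text \<open>The point of interest is 0, a coordinate of every distribution on the boundary of the simplex;
  there the claim is that \<open>ln y / y\<close> tends to 0 as \<open>y = 1 / x\<close> tends to infinity.\<close>

lemma continuous_on_mult_ln:
  fixes c :: real
  assumes "0 < c"
  shows "continuous_on {0..} (\<lambda>x. x * ln (x * c))"
proof -
  have "((\<lambda>x::real. x * ln (x * c)) \<longlongrightarrow> 0 * ln (0 * c)) (at 0 within {0..})"
  proof -
    have "((\<lambda>x::real. - (ln (inverse x) / inverse x) + x * ln c) \<longlongrightarrow> - 0 + 0 * ln c) (at_right 0)"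
      by (intro tendsto_add tendsto_minus tendsto_mult tendsto_const tendsto_ident_at
          filterlim_compose[OF ln_x_over_x_tendsto_0 filterlim_inverse_at_top_right])
    moreover have "eventually (\<lambda>x. - (ln (inverse x) / inverse x) + x * ln c = x * ln (x * c)) (at_right 0)"
      using eventually_at_right_less[of 0] by eventually_elim
        (use assms in \<open>simp add: ln_inverse ln_mult divide_inverse algebra_simps\<close>)
    ultimately show ?thesis
      by (simp add: at_within_Ici_at_right tendsto_cong)
  qed
  moreover have "isCont (\<lambda>x. x * ln (x * c)) x" if "x > 0" for x
    using that assms by (intro continuous_intros) auto
  ultimately show ?thesis
    unfolding continuous_on_def isCont_def
    by (metis atLeast_iff order_le_imp_less_or_eq tendsto_within_subset top_greatest)
qed

lemma continuous_on_Psi: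
  fixes A :: "'m::finite \<Rightarrow> real^'n::finite^'n"
  assumes inv: "\<And>h. invertible (A h)"
  shows "continuous_on prob_simplex (Psi A)"
proof -
  have "continuous_on prob_simplex
      (\<lambda>\<nu>::real^'m. \<nu> $ h * ln (\<nu> $ h * (Delta A h / delta A h ^ CARD('n))))" for h
    using delta_pos[of A h, OF inv] Delta_pos[of A h, OF inv]
    by (intro continuous_on_compose2[OF continuous_on_mult_ln] continuous_intros)
      (auto simp: prob_simplex_def)
  then have "continuous_on prob_simplex (\<lambda>\<nu>. \<Sum>h\<in>UNIV.
      \<nu> $ h * ln (\<nu> $ h * (Delta A h / delta A h ^ CARD('n))))"
    by (intro continuous_on_sum) auto
  then show ?thesis unfolding Psi_def[abs_def] by simp
qed

text \<open>As \<open>\<beta>\<close> decreases to minus infinity, the tilted distribution concentrates on the matrices whose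
  smallest singular value is minimal.\<close>

lemma nu_hat_tendsto_at_bot:
  fixes A :: "'m::finite \<Rightarrow> real^'n::finite^'n"
  assumes inv: "\<And>h. invertible (A h)"
  defines "H \<equiv> {h. delta A h = (MIN j. delta A j)}"
  shows "((\<lambda>\<beta>. nu_hat A UNIV \<beta>) \<longlongrightarrow> nu_hat A H 0) at_bot"
proof (rule vec_tendstoI)
  fix h
  \<comment> \<open>Dividing numerator and denominator by \<open>d powr \<beta>\<close> makes all terms converge.\<close>
  define d where "d = (MIN j. delta A j)"
  have d: "0 < d" unfolding d_def using inv by (rule Min_delta_pos)
  have pos: "0 < delta A j" "0 < Delta A j" for j
    using delta_pos[of A j, OF inv] Delta_pos[of A j, OF inv] by auto
  define I where "I j = (if j \<in> H then 1 else 0 :: real)" for j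
  have ratio: "((\<lambda>\<beta>. (delta A j / d) powr \<beta>) \<longlongrightarrow> I j) at_bot" for j
  proof (cases "j \<in> H")
    case True
    then have "delta A j / d = 1" using d by (simp add: H_def d_def[symmetric])
    then show ?thesis using True by (simp add: I_def)
  next
    case False
    have "d \<le> delta A j" unfolding d_def by simp
    then have "d < delta A j" using False by (auto simp: H_def d_def[symmetric])
    then have l: "0 < ln (delta A j / d)" using d by simp
    have "((\<lambda>\<beta>. exp (ln (delta A j / d) * \<beta>)) \<longlongrightarrow> 0) at_bot"
      by (rule filterlim_compose[OF exp_at_bot])
        (rule filterlim_tendsto_pos_mult_at_bot[OF tendsto_const l filterlim_ident])
    then show ?thesis using False d pos[of j] by (simp add: I_def powr_def mult.commute)
  qed
  have "H \<noteq> {}" unfolding H_def using Min_delta_attained[of A] by blast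
  then have "0 < (\<Sum>j\<in>H. inverse (Delta A j))" using pos by (intro sum_pos) auto
  moreover have sumI: "(\<Sum>j\<in>UNIV. I j * inverse (Delta A j)) = (\<Sum>j\<in>H. inverse (Delta A j))"
    unfolding I_def by (simp add: if_distrib[of "\<lambda>x. x * _"] sum.If_cases cong: if_cong)
  ultimately have "((\<lambda>\<beta>. (delta A h / d) powr \<beta> * inverse (Delta A h) /
        (\<Sum>j\<in>UNIV. (delta A j / d) powr \<beta> * inverse (Delta A j)))
      \<longlongrightarrow> I h * inverse (Delta A h) / (\<Sum>j\<in>UNIV. I j * inverse (Delta A j))) at_bot"
    by (intro tendsto_divide tendsto_sum tendsto_mult ratio tendsto_const) simp
  moreover have "(delta A h / d) powr \<beta> * inverse (Delta A h) /
      (\<Sum>j\<in>UNIV. (delta A j / d) powr \<beta> * inverse (Delta A j)) = nu_hat A UNIV \<beta> $ h" for \<beta>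
  proof -
    have "(delta A j / d) powr \<beta> * inverse (Delta A j)
        = (delta A j powr \<beta> * inverse (Delta A j)) / d powr \<beta>" for j
      using pos[of j] d by (simp add: powr_divide)
    then show ?thesis
      using d by (simp add: nu_hat_UNIV_nth partition_sum_def sum_divide_distrib[symmetric])
  qed
  moreover have "I h * inverse (Delta A h) / (\<Sum>j\<in>UNIV. I j * inverse (Delta A j)) = nu_hat A H 0 $ h"
  proof -
    have "delta A j powr 0 = 1" for j using pos[of j] by simp
    then show ?thesis unfolding sumI by (simp add: nu_hat_def I_def)
  qed
  ultimately show "((\<lambda>\<beta>. nu_hat A UNIV \<beta> $ h) \<longlongrightarrow> nu_hat A H 0 $ h) at_bot" by simp
qed

text \<open>Follow the curve of tilted distributions from \<open>nu_bar\<close>, where \<open>\<beta> = 0\<close> and \<open>Psi\<close> is negative,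
  towards \<open>\<beta> = - \<infinity>\<close>. Either \<open>Psi\<close> changes sign on the way, or it is still nonpositive at the limit
  point; then it vanishes between that point and a vertex of the face in which it lies.\<close>

lemma Psi_zero_cases:
  fixes A :: "'m::finite \<Rightarrow> real^'n::finite^'n"
  assumes inv: "\<And>h. invertible (A h)" and neg: "Psi A (nu_bar A) < 0"
  obtains (tilted) \<beta> where "\<beta> < 0" "Psi A (nu_hat A UNIV \<beta>) = 0"
  | (face) \<nu> where "\<nu> \<in> Psi_zeros A" "\<forall>h. \<nu> $ h \<noteq> 0 \<longrightarrow> delta A h = (MIN j. delta A j)"
proof -
  define H where "H = {h. delta A h = (MIN j. delta A j)}"
  obtain h0 where h0: "h0 \<in> H" unfolding H_def using Min_delta_attained[of A] by blast
  then have Hne: "H \<noteq> {}" by blast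
  have simp_hat: "nu_hat A S \<beta> \<in> prob_simplex" if "S \<noteq> {}" for S \<beta>
    using inv that by (rule nu_hat_in_prob_simplex)
  have cont: "continuous_on prob_simplex (Psi A)" using inv by (rule continuous_on_Psi)
  show thesis
  proof (cases "Psi A (nu_hat A H 0) \<le> 0")
    case True
    define F where "F = {\<nu> \<in> prob_simplex. \<forall>h. h \<notin> H \<longrightarrow> \<nu> $ h = (0::real)}"
    have "convex F"
    proof (rule convexI)
      fix x y :: "real^'m" and u v :: real
      assume xy: "x \<in> F" "y \<in> F" and uv: "0 \<le> u" "0 \<le> v" "u + v = 1"
      have "u * x $ h + v * y $ h \<le> 1" for h
        using xy uv by (intro convex_bound_le) (auto simp: F_def prob_simplex_def)
      then show "u *\<^sub>R x + v *\<^sub>R y \<in> F"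
        using xy uv by (auto simp: F_def prob_simplex_def sum.distrib sum_distrib_left[symmetric])
    qed
    then have "connected (Psi A ` F)"
      by (intro connected_continuous_image continuous_on_subset[OF cont] convex_connected)
        (auto simp: F_def)
    moreover have "nu_hat A H 0 \<in> F" using simp_hat[OF Hne] by (simp add: F_def nu_hat_def)
    moreover have "axis h0 1 \<in> F"
      using h0 by (auto simp: F_def prob_simplex_def axis_def)
    ultimately have "0 \<in> Psi A ` F"
      using True Psi_vertex_nonneg[of A h0, OF inv] by (auto intro: connectedD_interval)
    then obtain \<nu> where "\<nu> \<in> F" "Psi A \<nu> = 0" by force
    then show thesis by (intro face[of \<nu>]) (auto simp: F_def Psi_zeros_def H_def)
  next
    case False
    have "((\<lambda>\<beta>. Psi A (nu_hat A UNIV \<beta>)) \<longlongrightarrow> Psi A (nu_hat A H 0)) at_bot"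
      using nu_hat_tendsto_at_bot[of A, OF inv] simp_hat Hne
      by (intro continuous_on_tendsto_compose[OF cont]) (auto simp: H_def)
    then have "eventually (\<lambda>\<beta>. 0 < Psi A (nu_hat A UNIV \<beta>)) at_bot"
      using False by (intro order_tendstoD(1)) auto
    then obtain b' where b': "\<And>\<beta>. \<beta> \<le> b' \<Longrightarrow> 0 < Psi A (nu_hat A UNIV \<beta>)"
      by (auto simp: eventually_at_bot_linorder)
    define b where "b = min b' 0"
    have b: "b \<le> 0" "0 < Psi A (nu_hat A UNIV b)" by (auto simp: b_def intro: b')
    have "continuous_on {b..0} (\<lambda>\<beta>. nu_hat A UNIV \<beta>)"
      unfolding nu_hat_def
      using delta_pos[of A, OF inv] nu_hat_sum_pos[of A UNIV, OF inv]
      by (intro continuous_on_vec_lambda) (auto intro!: continuous_intros simp: less_imp_neq[symmetric])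
    then have "continuous_on {b..0} (\<lambda>\<beta>. Psi A (nu_hat A UNIV \<beta>))"
      using simp_hat by (intro continuous_on_compose2[OF cont]) auto
    then obtain \<beta> where "\<beta> \<le> 0" "Psi A (nu_hat A UNIV \<beta>) = 0"
      using IVT2'[of "\<lambda>\<beta>. Psi A (nu_hat A UNIV \<beta>)" 0 0 b] b neg
      by (auto simp: nu_bar_eq_nu_hat[of A, OF inv])
    moreover have "\<beta> \<noteq> 0" using calculation neg by (auto simp: nu_bar_eq_nu_hat[of A, OF inv])
    ultimately show thesis by (intro tilted[of \<beta>]) auto
  qed
qed

section \<open>The minimum of \<open>delta_prod\<close> over the zeros of \<open>Psi\<close>\<close>

text \<open>Off the face, the minimiser is a tilted distribution, and the minimum is precisely the bound
  that the covering argument gives at the same \<open>\<beta>\<close>; on the face, it is the trivial bound. For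
  pairwise different \<open>\<delta>\<close> the face is a single vertex.\<close>

lemma delta_prod_minimizer:
  fixes A :: "'m::finite \<Rightarrow> real^'n::finite^'n"
  assumes inv: "\<And>h. invertible (A h)" and neg: "Psi A (nu_bar A) < 0"
  shows "\<exists>\<mu>\<in>Psi_zeros A. (\<forall>\<nu>\<in>Psi_zeros A. delta_prod A \<mu> \<le> delta_prod A \<nu>) \<and>
    delta_prod A \<mu> \<le> stabilizability_radius A \<and>
    (inj (delta A) \<longrightarrow> (\<exists>\<beta> S. S \<noteq> {} \<and> \<mu> = nu_hat A S \<beta>) \<and>
      (\<forall>\<nu>\<in>Psi_zeros A. delta_prod A \<nu> \<le> delta_prod A \<mu> \<longrightarrow> \<nu> = \<mu>))"
  using inv neg
proof (cases rule: Psi_zero_cases)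
  case (tilted \<beta>)
  let ?p = "nu_hat A UNIV \<beta>"
  have n: "\<beta> < real CARD('n)" using tilted(1) by simp
  have p: "?p \<in> Psi_zeros A"
    using nu_hat_in_prob_simplex[of A UNIV \<beta>, OF inv] tilted(2) by (simp add: Psi_zeros_def)
  have less: "delta_prod A ?p < delta_prod A \<nu>" if "\<nu> \<in> Psi_zeros A" "\<nu> \<noteq> ?p" for \<nu>
    using inv n tilted(2) that by (rule nu_hat_strict_minimizer)
  have "delta_prod A ?p \<le> stabilizability_radius A"
    using stabilizability_radius_ge_partition_sum[of A \<beta>, OF inv] tilted(1)
      delta_prod_nu_hat[of A \<beta>, OF inv n tilted(2)] by simp
  moreover have "delta_prod A ?p \<le> delta_prod A \<nu>" if "\<nu> \<in> Psi_zeros A" for \<nu>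
    using less[OF that] by fastforce
  moreover have "(\<exists>\<beta>' S. S \<noteq> {} \<and> ?p = nu_hat A S \<beta>') \<and>
      (\<forall>\<nu>\<in>Psi_zeros A. delta_prod A \<nu> \<le> delta_prod A ?p \<longrightarrow> \<nu> = ?p)"
    using less by (auto simp: not_le[symmetric])
  ultimately show ?thesis using p by (intro bexI[of _ ?p]) blast+
next
  case (face \<mu>)
  have Z: "\<nu> \<in> prob_simplex" if "\<nu> \<in> Psi_zeros A" for \<nu> using that by (simp add: Psi_zeros_def)
  have val: "delta_prod A \<mu> = (MIN h. delta A h)"
    using Min_delta_le_delta_prod(2)[of A \<mu>, OF inv Z[OF face(1)]] face(2) by blast
  have "delta_prod A \<mu> \<le> delta_prod A \<nu>" if "\<nu> \<in> Psi_zeros A" for \<nu>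
    unfolding val using inv Z[OF that] by (rule Min_delta_le_delta_prod(1))
  moreover have "delta_prod A \<mu> \<le> stabilizability_radius A"
    unfolding val using inv by (rule stabilizability_radius_ge_Min_delta)
  moreover have "(\<exists>\<beta> S. S \<noteq> {} \<and> \<mu> = nu_hat A S \<beta>) \<and>
      (\<forall>\<nu>\<in>Psi_zeros A. delta_prod A \<nu> \<le> delta_prod A \<mu> \<longrightarrow> \<nu> = \<mu>)" if inj: "inj (delta A)"
  proof -
    obtain h0 where h0: "delta A h0 = (MIN j. delta A j)" using Min_delta_attained[of A] by blast
    have vertex: "\<nu> = nu_hat A {h0} 0"
      if \<nu>: "\<nu> \<in> prob_simplex" and supp: "\<forall>h. \<nu> $ h \<noteq> 0 \<longrightarrow> delta A h = (MIN j. delta A j)" for \<nu>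
    proof -
      have off: "\<nu> $ h = 0" if "h \<noteq> h0" for h
        using supp inj h0 that by (metis injD)
      have "(\<Sum>h\<in>UNIV. \<nu> $ h) = (\<Sum>h\<in>{h0}. \<nu> $ h)"
        by (rule sum.mono_neutral_right) (auto simp: off)
      then have "\<nu> $ h0 = 1" using \<nu> by (simp add: prob_simplex_def)
      then show ?thesis
        using off delta_pos[of A h0, OF inv] Delta_pos[of A h0, OF inv]
        by (auto simp: vec_eq_iff nu_hat_def)
    qed
    have "\<mu> = nu_hat A {h0} 0" using vertex[OF Z[OF face(1)] face(2)] .
    moreover have "\<nu> = nu_hat A {h0} 0"
      if "\<nu> \<in> Psi_zeros A" "delta_prod A \<nu> \<le> delta_prod A \<mu>" for \<nu>
    proof -
      have "delta_prod A \<nu> = (MIN h. delta A h)"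
        using that(2) Min_delta_le_delta_prod(1)[of A \<nu>, OF inv Z[OF that(1)]] val by linarith
      then show ?thesis
        using vertex[OF Z[OF that(1)]] Min_delta_le_delta_prod(2)[of A \<nu>, OF inv Z[OF that(1)]] by blast
    qed
    ultimately show ?thesis by blast
  qed
  ultimately show ?thesis using face(1) by (intro bexI[of _ \<mu>]) blast+
qed

theorem theorem3:
  fixes A :: "'m::finite \<Rightarrow> real^'n::finite^'n"
  assumes nonsingular: "\<And>h. invertible (A h)"
  shows "(Psi A (nu_bar A) \<ge> 0 \<longrightarrow>
            stabilizability_radius A \<ge> rho_minus A \<and>
            rho_minus A \<ge> (MIN h. delta A h))
       \<and> (Psi A (nu_bar A) < 0 \<longrightarrow>
            Psi_zeros A \<noteq> {} \<and>
            (\<exists>\<nu>. is_arg_min (delta_prod A) (\<lambda>\<nu>. \<nu> \<in> Psi_zeros A) \<nu>) \<and>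
            rho_minus_star A \<ge> (MIN h. delta A h) \<and>
            stabilizability_radius A \<ge> rho_minus_star A \<and>
            rho_minus_star A > rho_minus A \<and>
            ((\<forall>i j. i \<noteq> j \<longrightarrow> delta A i \<noteq> delta A j) \<longrightarrow>
               (\<exists>!\<nu>. is_arg_min (delta_prod A) (\<lambda>\<nu>. \<nu> \<in> Psi_zeros A) \<nu>) \<and>
               (\<forall>\<nu>. is_arg_min (delta_prod A) (\<lambda>\<nu>. \<nu> \<in> Psi_zeros A) \<nu> \<longrightarrow>
                  (\<exists>\<beta> S. S \<noteq> {} \<and> \<nu> = nu_hat A S \<beta>)) \<and>
               rho_minus_star A \<in> {delta_prod A (nu_hat A S \<beta>) | S \<beta>.
                                      S \<noteq> {} \<and> Psi A (nu_hat A S \<beta>) = 0} \<and>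
               (\<forall>r \<in> {delta_prod A (nu_hat A S \<beta>) | S \<beta>.
                          S \<noteq> {} \<and> Psi A (nu_hat A S \<beta>) = 0}.
                  rho_minus_star A \<le> r)))"

proof (intro conjI impI)
  assume "0 \<le> Psi A (nu_bar A)"
  show "rho_minus A \<le> stabilizability_radius A"
    using stabilizability_radius_ge_partition_sum[of A 0, OF nonsingular]
    by (simp add: rho_minus_eq_partition_sum[of A, OF nonsingular])
  have "(MIN h. delta A h) \<le> delta_prod A (nu_bar A)"
    using nonsingular nu_bar_props(1)[of A, OF nonsingular] by (rule Min_delta_le_delta_prod(1))
  also have "\<dots> \<le> rho_minus A"
    using nonsingular \<open>0 \<le> Psi A (nu_bar A)\<close> by (rule delta_prod_nu_bar_le_rho_minus)
  finally show "(MIN h. delta A h) \<le> rho_minus A" .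
next
  assume neg: "Psi A (nu_bar A) < 0"
  obtain \<mu> where \<mu>: "\<mu> \<in> Psi_zeros A" "\<forall>\<nu>\<in>Psi_zeros A. delta_prod A \<mu> \<le> delta_prod A \<nu>"
    "delta_prod A \<mu> \<le> stabilizability_radius A"
    and distinct: "inj (delta A) \<longrightarrow> (\<exists>\<beta> S. S \<noteq> {} \<and> \<mu> = nu_hat A S \<beta>) \<and>
      (\<forall>\<nu>\<in>Psi_zeros A. delta_prod A \<nu> \<le> delta_prod A \<mu> \<longrightarrow> \<nu> = \<mu>)"
    using delta_prod_minimizer[of A, OF nonsingular neg] by (elim bexE conjE)
  have star: "rho_minus_star A = delta_prod A \<mu>"
    unfolding rho_minus_star_def using \<mu>(1,2) by (intro Least_equality) auto
  have argmin: "is_arg_min (delta_prod A) (\<lambda>\<nu>. \<nu> \<in> Psi_zeros A) \<nu> \<longleftrightarrow>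
      \<nu> \<in> Psi_zeros A \<and> delta_prod A \<nu> \<le> delta_prod A \<mu>" for \<nu>
    unfolding is_arg_min_def using \<mu>(1,2) by (meson not_le order.trans)
  show "Psi_zeros A \<noteq> {}" using \<mu>(1) by blast
  show "\<exists>\<nu>. is_arg_min (delta_prod A) (\<lambda>\<nu>. \<nu> \<in> Psi_zeros A) \<nu>"
    using \<mu>(1) unfolding argmin by blast
  show "(MIN h. delta A h) \<le> rho_minus_star A"
    unfolding star using nonsingular by (rule Min_delta_le_delta_prod(1)) (use \<mu>(1) in \<open>simp add: Psi_zeros_def\<close>)
  show "rho_minus_star A \<le> stabilizability_radius A" unfolding star by (rule \<mu>(3))
  show "rho_minus A < rho_minus_star A"
    unfolding star using nonsingular neg \<mu>(1) by (rule rho_minus_less_delta_prod)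
  assume "\<forall>i j. i \<noteq> j \<longrightarrow> delta A i \<noteq> delta A j"
  then have "inj (delta A)" by (metis injI)
  with distinct obtain \<beta>0 S0 where hat: "S0 \<noteq> {}" "\<mu> = nu_hat A S0 \<beta>0"
    and uniq: "\<And>\<nu>. \<nu> \<in> Psi_zeros A \<Longrightarrow> delta_prod A \<nu> \<le> delta_prod A \<mu> \<Longrightarrow> \<nu> = \<mu>" by blast
  show "\<exists>!\<nu>. is_arg_min (delta_prod A) (\<lambda>\<nu>. \<nu> \<in> Psi_zeros A) \<nu>"
    unfolding argmin using \<mu>(1) uniq by blast
  show "\<forall>\<nu>. is_arg_min (delta_prod A) (\<lambda>\<nu>. \<nu> \<in> Psi_zeros A) \<nu> \<longrightarrow>
      (\<exists>\<beta> S. S \<noteq> {} \<and> \<nu> = nu_hat A S \<beta>)"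
    unfolding argmin using uniq hat by blast
  have "Psi A \<mu> = 0" using \<mu>(1) by (simp add: Psi_zeros_def)
  then show "rho_minus_star A \<in> {delta_prod A (nu_hat A S \<beta>) | S \<beta>.
      S \<noteq> {} \<and> Psi A (nu_hat A S \<beta>) = 0}"
    unfolding star using hat by blast
  have "nu_hat A S \<beta> \<in> Psi_zeros A" if "S \<noteq> {}" "Psi A (nu_hat A S \<beta>) = 0" for S \<beta>
    using nu_hat_in_prob_simplex[of A S \<beta>, OF nonsingular that(1)] that(2) by (simp add: Psi_zeros_def)
  then show "\<forall>r \<in> {delta_prod A (nu_hat A S \<beta>) | S \<beta>. S \<noteq> {} \<and> Psi A (nu_hat A S \<beta>) = 0}.
      rho_minus_star A \<le> r"
    unfolding star using \<mu>(2) by blast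
qed

end
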